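(* Let $B(n,k)=\dfrac{\binom{n}{k}\binom{n+1}{k}\binom{n+2}{k}}{\binom{k+1}{k}\binom{k+2}{k}}$ for $0\le k\le n$. If $(a_k)_{k\ge 0}$ is a log-convex sequence of nonnegative real numbers, then the sequence $(b_n)_{n\ge0}$ defined by $$b_n=\sum_{k=0}^{n}B(n,k)\,a_k,\qquad n\ge 0,$$ is log-convex.
   Context: A sequence $(a_n)_{n\ge0}$ of nonnegative real numbers is log-convex if $a_n^2\le a_{n-1}a_{n+1}$ for all $n\ge1$. *)

theory Defs
  imports Complex_Main
begin

definition log_convex :: "(nat \<Rightarrow> real) \<Rightarrow> bool" where
  "log_convex a \<longleftrightarrow> (\<forall>n. 0 \<le> a n) \<and> (\<forall>n\<ge>1. (a n)\<^sup>2 \<le> a (n - 1) * a (n + 1))"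

definition B_coeff :: "nat \<Rightarrow> nat \<Rightarrow> real" where
  "B_coeff n k =
     (real (n choose k) * real ((n + 1) choose k) * real ((n + 2) choose k)) /
     (real ((k + 1) choose k) * real ((k + 2) choose k))"

end

theory Submission
  imports Defs
begin

text \<open>
  Expand \<open>b (n - 1) * b (n + 1) - (b n)\<^sup>2\<close> as a quadratic form in \<open>a\<close> and collect the terms
  \<open>a k * a j\<close> with a fixed index sum \<open>k + j = t\<close>. Each such antidiagonal sum turns out to be
  nonnegative. Its coefficients \<open>cross n k j + cross n j k\<close> are in general negative near \<open>k = j\<close> and
  positive far from it, whereas log-convexity says that \<open>a k * a j\<close> grows as \<open>k\<close> and \<open>j\<close> move apart. So
  it suffices to pay for the negative coefficients in the middle by moving coefficient mass inwards
  from the outer positions: that only lowers the value of the sum.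

  The transport is given by an explicit antisymmetric function \<open>flux n i j\<close>, the amount moved from
  position \<open>(i, j + 1)\<close> to position \<open>(i + 1, j)\<close>. It is nonnegative for \<open>i \<le> j\<close>, and
  lemma \<open>cross_plus_inflow_nonneg\<close> says that it makes every coefficient nonnegative.

  The amount is determined as follows. Up to the factor
  \<open>B_coeff n i * B_coeff n j * (j - i) / n\<close>, with \<open>x = n + 1 - k\<close> and \<open>y = n + 1 - j\<close>, the terms of
  top degree in the inequality allow at most
  \<open>(x\<^sup>2 + x * y + y\<^sup>2)\<^sup>2 / (k\<^sup>2 * y\<^sup>2 + k * j * x * y + j\<^sup>2 * x\<^sup>2)\<close>, whereas on the diagonal
  \<open>k = j\<close> an amount that agrees with this bound to leading order is needed. The quotient
  \<open>flux_num\<^sup>2 / flux_den\<close> has exactly this leading part, written in terms of \<open>T = k + j + 3\<close>,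
  \<open>P = 2 * n + 3 - k - j\<close> and the squared distance from the diagonal; its lower terms are such that
  the need on the diagonal is met with equality and that \<open>flux_den\<close> is symmetric in \<open>P\<close> and \<open>T\<close>,
  in accordance with the symmetry \<open>k \<mapsto> n - k\<close> of row \<open>n\<close>. With this choice the balance at each
  position factors (lemma \<open>balance_identity\<close>) into evidently nonnegative factors and one
  polynomial \<open>surplus\<close>, again symmetric in \<open>P\<close> and \<open>T\<close>, whose sign follows from an elementary
  estimate.
\<close>

section \<open>The polynomial identity behind the transport\<close>

definition rise3 :: "real \<Rightarrow> real" where "rise3 m = m * (m + 1) * (m + 2)"

definition flux_num :: "real \<Rightarrow> real \<Rightarrow> real" where
  "flux_num P E = 3 * P\<^sup>2 + E - 4"

text \<open>
  Here \<open>E\<close> is the squared distance of a flow from the diagonal. The flows into a diagonal position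
  have \<open>E = 1\<close>, where \<open>flux_num\<^sup>2 / flux_den\<close> reduces to \<open>3 * (P\<^sup>2 - 1) / (T\<^sup>2 - 1)\<close>.
\<close>
definition flux_den :: "real \<Rightarrow> real \<Rightarrow> real \<Rightarrow> real" where
  "flux_den P T E = 3 * P\<^sup>2 * T\<^sup>2 + 8 * P * T * (E - 1) + (E - 4) * (P\<^sup>2 + T\<^sup>2 + 3 * E - 4)"

text \<open>
  What is left over at a position after the transport, up to nonnegative factors; here \<open>e = (j - k)\<^sup>2\<close>.
\<close>
definition surplus :: "real \<Rightarrow> real \<Rightarrow> real \<Rightarrow> real" where
  "surplus P T e =
     9 * (P * T) ^ 3 + (13 * e - 37) * (P * T)\<^sup>2 + (e - 13) * (P * T) * (P\<^sup>2 + T\<^sup>2)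
     + (e - 1) * (e - 9) * (P\<^sup>2 + T\<^sup>2) + (5 * e\<^sup>2 - 38 * e + 81) * (P * T)
     + (e - 1) * (e - 5) * (e - 9)"

text \<open>
  The first line is the coefficient \<open>cross n k j + cross n j k\<close> up to a positive factor, and the
  next two are, for \<open>d \<ge> 1\<close>, the inflow from outside and the outflow towards the centre, at
  \<open>j = k + d\<close>; all are multiplied by the denominators of the two flows. Here \<open>x = n + 1 - k\<close> and \<open>y = n + 1 - j\<close>. The
  factor \<open>d\<^sup>2\<close> reflects that on the diagonal the inflow from both sides compensates the negative
  coefficient exactly.
\<close>
lemma balance_identity:
  fixes k y d :: real
  assumes "j = k + d" "x = y + d" "n = k + d + y - 1"
    and "P = 2 * y + d + 1" "T = 2 * k + d + 3"
  shows "((n + 3) * (rise3 (x - 1) * rise3 x + rise3 (y - 1) * rise3 y) - 2 * n * rise3 x * rise3 y)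
           * flux_den P T ((d + 1)\<^sup>2) * flux_den P T ((d - 1)\<^sup>2)
         + rise3 k * rise3 y * (d + 1) * (flux_num P ((d + 1)\<^sup>2))\<^sup>2 * flux_den P T ((d - 1)\<^sup>2)
         - rise3 j * rise3 x * (d - 1) * (flux_num P ((d - 1)\<^sup>2))\<^sup>2 * flux_den P T ((d + 1)\<^sup>2)
       = 48 * d\<^sup>2 * rise3 x * rise3 y * surplus P T (d\<^sup>2)"
  unfolding assms rise3_def flux_num_def flux_den_def surplus_def
  by algebra

lemma rise3_nonneg: "0 \<le> m \<Longrightarrow> 0 \<le> rise3 m"
  by (simp add: rise3_def)

lemma flux_den_pos:
  assumes "2 \<le> P" "3 \<le> T" "0 \<le> E"
  shows "0 < flux_den P T E"
proof -
  have PT: "6 \<le> P * T"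
    using mult_mono[of 2 P 3 T] assms by simp
  have P2: "4 \<le> P\<^sup>2" and T2: "9 \<le> T\<^sup>2"
    using power_mono[of 2 P 2] power_mono[of 3 T 2] assms by simp_all
  (* The value at E = 0 and the increment from there are positive separately. *)
  have "flux_den P T E = (P\<^sup>2 - 4) * (T\<^sup>2 - 4) + 2 * (P * T) * (P * T - 4)
      + E * (8 * (P * T) + P\<^sup>2 + T\<^sup>2 + 3 * E - 16)"
    unfolding flux_den_def by algebra
  moreover have "0 \<le> (P\<^sup>2 - 4) * (T\<^sup>2 - 4)"
    using P2 T2 by simp
  moreover have "0 < 2 * (P * T) * (P * T - 4)"
    using PT by simp
  moreover have "0 \<le> E * (8 * (P * T) + P\<^sup>2 + T\<^sup>2 + 3 * E - 16)"
    using PT P2 T2 assms(3) by (intro mult_nonneg_nonneg) linarith+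
  ultimately show ?thesis by linarith
qed

text \<open>
  The dominant term is \<open>9 * (P * T) ^ 3\<close>: for \<open>P \<ge> 2\<close> and \<open>T \<ge> 4\<close> the sum \<open>P\<^sup>2 + T\<^sup>2\<close> is at most
  \<open>5 / 16\<close> of \<open>(P * T)\<^sup>2\<close>, with equality at the corner, so the cubic term absorbs the
  negative terms that remain after squares are completed in \<open>f = e - 1\<close>.
\<close>
lemma surplus_nonneg:
  assumes P: "2 \<le> P" and T: "4 \<le> T" and e: "1 \<le> e"
  shows "0 \<le> surplus P T e"
proof -
  define f m q where "f = e - 1" and "m = P * T" and "q = P\<^sup>2 + T\<^sup>2"
  have f: "0 \<le> f" using e by (simp add: f_def)
  have m: "8 \<le> m" using mult_mono[of 2 P 4 T] P T by (simp add: m_def)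
  have P2: "4 \<le> P\<^sup>2" and T2: "16 \<le> T\<^sup>2"
    using power_mono[of 2 P 2] power_mono[of 4 T 2] P T by simp_all
  have q0: "0 \<le> q" by (simp add: q_def)
  have q: "16 * q \<le> 5 * m\<^sup>2"
    using mult_left_mono[OF P2, of "T\<^sup>2"] mult_left_mono[OF T2, of "P\<^sup>2"]
    by (simp add: q_def m_def power_mult_distrib algebra_simps)
  have "surplus P T e = (9 * m ^ 3 - 24 * m\<^sup>2 - 12 * m * q - 16 * q)
      + (q * (f - 4)\<^sup>2 + f * m * q) + m * (5 * (f - 3)\<^sup>2 + 2 * f + 3) + f * (f - 6)\<^sup>2
      + f * (13 * m\<^sup>2 - 4)"
    unfolding surplus_def f_def m_def q_def by algebra
  moreover have "0 \<le> 9 * m ^ 3 - 24 * m\<^sup>2 - 12 * m * q - 16 * q"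
  proof -
    have "0 \<le> m\<^sup>2 * (21 * m - 116) / 4" using m by simp
    also have "\<dots> = 9 * m ^ 3 - 24 * m\<^sup>2 - 12 * m * (5 * m\<^sup>2 / 16) - 16 * (5 * m\<^sup>2 / 16)"
      by (simp add: field_simps power2_eq_square power3_eq_cube)
    also have "\<dots> \<le> 9 * m ^ 3 - 24 * m\<^sup>2 - 12 * m * q - 16 * q"
      using q m by (intro diff_mono mult_left_mono) auto
    finally show ?thesis .
  qed
  moreover have "0 \<le> q * (f - 4)\<^sup>2 + f * m * q" using f m q0 by simp
  moreover have "0 \<le> m * (5 * (f - 3)\<^sup>2 + 2 * f + 3)" using f m by simp
  moreover have "0 \<le> f * (f - 6)\<^sup>2" using f by simp
  moreover have "0 \<le> f * (13 * m\<^sup>2 - 4)"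
    using f power_mono[OF m, of 2] by (intro mult_nonneg_nonneg) auto
  ultimately show ?thesis by linarith
qed

section \<open>Neighbouring coefficients\<close>

lemma B_coeff_nonneg: "0 \<le> B_coeff n k"
  by (simp add: B_coeff_def)

lemma B_coeff_eq_0: "n < k \<Longrightarrow> B_coeff n k = 0"
  by (simp add: B_coeff_def)

lemma B_coeff_explicit:
  "B_coeff n k = 2 * (real (n choose k) * real (Suc n choose k) * real (Suc (Suc n) choose k))
     / ((real k + 1)\<^sup>2 * (real k + 2))"
proof -
  have "(k + 1) choose k = k + 1"
    using binomial_symmetric[of k "k+1"] by simp
  hence one: "real ((k + 1) choose k) = real k + 1"
    by simp
  have "2 * ((k + 2) choose k) = (k + 2) * (k + 1)"
    using binomial_symmetric[of k "k+2"] choose_two[of "k+2"] by simp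
  hence "real (2 * ((k + 2) choose k)) = real ((k + 2) * (k + 1))"
    by (simp only:)
  hence two: "real ((k + 2) choose k) = (real k + 2) * (real k + 1) / 2"
    by (simp add: algebra_simps)
  show ?thesis
    unfolding B_coeff_def one two by (simp add: power2_eq_square mult_ac)
qed

lemma binomial_lower_row:
  assumes "k \<le> Suc n"
  shows "(real n + 1) * real (n choose k) = (real n + 1 - real k) * real (Suc n choose k)"
proof -
  have "(Suc n - k) * (Suc n choose k) = Suc n * (n choose k)"
    using binomial_absorb_comp[of "Suc n" k] by simp
  hence "real (Suc n - k) * real (Suc n choose k) = real (Suc n) * real (n choose k)"
    by (simp only: flip: of_nat_mult)
  thus ?thesis using assms by (simp add: of_nat_diff algebra_simps)
qed

text \<open>
  The next two lemmas express the coefficients in row \<open>n\<close> through those in row \<open>n + 1\<close>, so that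
  all coefficients occurring at one position become rational multiples of the same product. They say
  that \<open>B_coeff\<close> is a binomial coefficient for factorials in which \<open>m\<close> is replaced by \<open>rise3 m\<close>.
\<close>
lemma B_coeff_lower_row:
  assumes "k \<le> Suc n"
  shows "rise3 (real n + 1) * B_coeff n k = rise3 (real n + 1 - real k) * B_coeff (Suc n) k"
proof -
  let ?c = "\<lambda>i. real ((n + i) choose k)"
  have "(real n + 1) * ?c 0 = (real n + 1 - real k) * ?c 1"
       "(real n + 2) * ?c 1 = (real n + 2 - real k) * ?c 2"
       "(real n + 3) * ?c 2 = (real n + 3 - real k) * ?c 3"
    using binomial_lower_row[of k n] binomial_lower_row[of k "n+1"] binomial_lower_row[of k "n+2"] assms
    by (simp_all add: numeral_2_eq_2 numeral_3_eq_3 add_ac)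
  hence "rise3 (real n + 1) * (?c 0 * ?c 1 * ?c 2) = rise3 (real n + 1 - real k) * (?c 1 * ?c 2 * ?c 3)"
    unfolding rise3_def by algebra
  thus ?thesis
    unfolding B_coeff_explicit by (simp add: numeral_2_eq_2 numeral_3_eq_3)
qed

lemma B_coeff_diagonal:
  "rise3 (real n + 1) * B_coeff n k = rise3 (real k + 1) * B_coeff (Suc n) (Suc k)"
proof -
  let ?c = "\<lambda>i. real ((n + i) choose k)" and ?c' = "\<lambda>i. real ((n + i) choose Suc k)"
  have *: "(real m + 1) * real (m choose k) = (real k + 1) * real (Suc m choose Suc k)" for m
  proof -
    have "real (Suc m * (m choose k)) = real (Suc k * (Suc m choose Suc k))"
      by (simp only: Suc_times_binomial)
    thus ?thesis by (simp only: of_nat_mult) (simp add: add.commute)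
  qed
  have "(real n + 1) * ?c 0 = (real k + 1) * ?c' 1"
       "(real n + 2) * ?c 1 = (real k + 1) * ?c' 2"
       "(real n + 3) * ?c 2 = (real k + 1) * ?c' 3"
    using *[of n] *[of "n+1"] *[of "n+2"]
    by (simp_all add: numeral_2_eq_2 numeral_3_eq_3 add_ac del: binomial_Suc_Suc)
  moreover define z where "z = ?c' 1 * ?c' 2 * ?c' 3"
  ultimately have z: "rise3 (real n + 1) * (?c 0 * ?c 1 * ?c 2) = (real k + 1) ^ 3 * z"
    unfolding rise3_def by algebra
  have "rise3 (real n + 1) * B_coeff n k
      = 2 * (rise3 (real n + 1) * (?c 0 * ?c 1 * ?c 2)) / ((real k + 1)\<^sup>2 * (real k + 2))"
    unfolding B_coeff_explicit by (simp add: numeral_2_eq_2 mult_ac)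
  also have "\<dots> = 2 * ((real k + 1) ^ 3 * z) / ((real k + 1)\<^sup>2 * (real k + 2))"
    by (simp only: z)
  also have "\<dots> = rise3 (real k + 1) * (2 * z / ((real k + 2)\<^sup>2 * (real k + 3)))"
    by (simp add: rise3_def power2_eq_square power3_eq_cube divide_simps add.commute)
  also have "2 * z / ((real k + 2)\<^sup>2 * (real k + 3)) = B_coeff (Suc n) (Suc k)"
    unfolding B_coeff_explicit z_def
    by (simp add: numeral_2_eq_2 numeral_3_eq_3 add_ac del: binomial_Suc_Suc)
  finally show ?thesis .
qed

section \<open>Transport towards the diagonal\<close>

text \<open>
  \<open>flux n i j\<close> is moved from position \<open>(i, j + 1)\<close> to position \<open>(i + 1, j)\<close>; the values of \<open>P\<close> and
  \<open>T\<close> are those belonging to the common index sum \<open>i + j + 1\<close> of the two positions.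
\<close>
definition flux :: "nat \<Rightarrow> nat \<Rightarrow> nat \<Rightarrow> real" where
  "flux n i j =
     (let P = 2 * real n + 2 - real i - real j; T = real i + real j + 4; E = (real j - real i)\<^sup>2
      in B_coeff n i * B_coeff n j * (real j - real i) * (flux_num P E)\<^sup>2 / (real n * flux_den P T E))"

text \<open>
  What position \<open>(k, j)\<close> receives from \<open>(k - 1, j + 1)\<close>, a neighbour that does not exist for
  \<open>k = 0\<close>. By antisymmetry of the flux, what it receives from the other neighbour \<open>(k + 1, j - 1)\<close>
  is \<open>inflow n j k\<close>.
\<close>
definition inflow :: "nat \<Rightarrow> nat \<Rightarrow> nat \<Rightarrow> real" where
  "inflow n k j = (case k of 0 \<Rightarrow> 0 | Suc i \<Rightarrow> flux n i j)"

text \<open>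
  The coefficient of \<open>a k * a j\<close> in \<open>b (n - 1) * b (n + 1) - b n * b n\<close>, before symmetrisation.
\<close>
definition cross :: "nat \<Rightarrow> nat \<Rightarrow> nat \<Rightarrow> real" where
  "cross n k j = B_coeff (n - 1) k * B_coeff (n + 1) j - B_coeff n k * B_coeff n j"

lemma flux_antisym: "flux n j i = - flux n i j"
proof -
  have "(real i - real j)\<^sup>2 = (real j - real i)\<^sup>2" by (rule power2_commute)
  thus ?thesis
    unfolding flux_def Let_def
    by (simp add: algebra_simps minus_divide_left)
qed

lemma flux_nonneg:
  assumes "i \<le> j"
  shows "0 \<le> flux n i j"
proof (cases "j \<le> n")
  case True
  show ?thesis
  proof (cases "i = j")
    case False
    have "0 < flux_den (2 * real n + 2 - real i - real j) (real i + real j + 4) ((real j - real i)\<^sup>2)"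
      using assms True by (intro flux_den_pos) auto
    thus ?thesis
      unfolding flux_def Let_def using assms
      by (intro divide_nonneg_nonneg mult_nonneg_nonneg B_coeff_nonneg) auto
  qed (simp add: flux_def)
qed (simp add: flux_def B_coeff_eq_0)

text \<open>
  All terms are multiples of \<open>B_coeff (n + 1) k * B_coeff (n + 1) j\<close>, by the relations between
  neighbouring coefficients; the remaining rational factor is nonnegative by \<open>balance_identity\<close>.
\<close>
lemma cross_plus_inflow_nonneg:
  assumes n: "1 \<le> n"
  shows "0 \<le> cross n k j + cross n j k + inflow n k j + inflow n j k"
proof (cases "k \<le> Suc n \<and> j \<le> Suc n \<and> k + j < 2 * Suc n")
  (* Beyond the support everything vanishes; at k = j = n + 1 the denominator of the flux vanishes
     too, so this corner has to be treated here. *)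
  case False
  have inflow0: "inflow n k j = 0" if "Suc n < k \<or> n < j" for k j
    using that by (auto simp: inflow_def flux_def B_coeff_eq_0 split: nat.splits)
  have cross0: "cross n k j = 0" if "n < k \<and> n < j \<or> Suc n < k \<or> Suc n < j" for k j
    using that by (auto simp: cross_def B_coeff_eq_0)
  have "n < k \<and> n < j \<or> Suc n < k \<or> Suc n < j" using False by auto
  thus ?thesis
    using inflow0[of k j] inflow0[of j k] cross0[of k j] cross0[of j k] by auto
next
  case True
  hence kj: "k \<le> Suc n" "j \<le> Suc n" "k + j < 2 * Suc n" by auto
  define d x y P T where "d = real j - real k" and "x = real n + 1 - real k"
    and "y = real n + 1 - real j" and "P = 2 * real n + 3 - real k - real j"
    and "T = real k + real j + 3"
  note defs = d_def x_def y_def P_def T_def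
  define N3 where "N3 = rise3 (real n + 1)"
  define u v where "u = B_coeff (Suc n) k" and "v = B_coeff (Suc n) j"
  define Dp Dm where "Dp = flux_den P T ((d + 1)\<^sup>2)" and "Dm = flux_den P T ((d - 1)\<^sup>2)"
  define Gp Gm where "Gp = (flux_num P ((d + 1)\<^sup>2))\<^sup>2" and "Gm = (flux_num P ((d - 1)\<^sup>2))\<^sup>2"
  have N3: "0 < N3" using n by (simp add: N3_def rise3_def)
  have N3': "rise3 (real n) \<noteq> 0" using n by (auto simp: rise3_def)
  have xy: "0 \<le> x" "0 \<le> y" using kj by (simp_all add: defs)
  have uv: "0 \<le> u * v" by (simp add: u_def v_def B_coeff_nonneg)
  have P: "2 \<le> P" and T: "3 \<le> T" using kj by (auto simp: defs)
  have Dp: "0 < Dp" and Dm: "0 < Dm"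
    unfolding Dp_def Dm_def using P T by (simp_all add: flux_den_pos)

  have row: "B_coeff n k = rise3 x * u / N3" "B_coeff n j = rise3 y * v / N3"
    using B_coeff_lower_row[of k n] B_coeff_lower_row[of j n] kj N3
    by (simp_all add: defs u_def v_def N3_def field_simps)
  (* Row n - 1 ends at n - 1; at k = n and k = n + 1, that is i = 1 and i = 0, both sides vanish. *)
  have row': "B_coeff (n - 1) k = rise3 (i - 1) * rise3 i * w / (N3 * rise3 (real n))"
    if i: "i = real n + 1 - real k" and w: "w = B_coeff (Suc n) k" and k: "k \<le> Suc n" for i w k
  proof -
    have "rise3 (real n) * B_coeff (n - 1) k = rise3 (i - 1) * B_coeff n k"
    proof (cases "k \<le> n")
      case True
      thus ?thesis using B_coeff_lower_row[of k "n - 1"] n i by (simp add: of_nat_diff)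
    next
      case False
      thus ?thesis by (simp add: B_coeff_eq_0)
    qed
    moreover have "N3 * B_coeff n k = rise3 i * w"
      using B_coeff_lower_row[OF k] i w N3_def by simp
    ultimately show ?thesis using N3 N3' by (simp add: field_simps)
  qed
  have in': "inflow n k j = rise3 (real k) * rise3 (real n + 1 - real j) * u * v * (real j - real k + 1)
      * (flux_num P ((real j - real k + 1)\<^sup>2))\<^sup>2
      / (N3\<^sup>2 * (real n * flux_den P T ((real j - real k + 1)\<^sup>2)))"
    if u: "u = B_coeff (Suc n) k" and v: "v = B_coeff (Suc n) j" and j: "j \<le> Suc n"
      and P: "P = 2 * real n + 3 - real k - real j" and T: "T = real k + real j + 3" for k j u v
  proof (cases k)
    case 0
    thus ?thesis by (simp add: inflow_def rise3_def)
  next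
    case (Suc i)
    have b: "B_coeff n i = rise3 (real k) * u / N3" "B_coeff n j = rise3 (real n + 1 - real j) * v / N3"
      using B_coeff_diagonal[of n i] B_coeff_lower_row[OF j] N3
      by (simp_all add: u v N3_def Suc field_simps)
    have eqs: "2 * real n + 2 - real i - real j = P" "real i + real j + 4 = T"
      "real j - real i = real j - real k + 1"
      using Suc by (simp_all add: P T)
    have "inflow n k j = flux n i j" by (simp add: inflow_def Suc)
    also have "\<dots> = (rise3 (real k) * u / N3) * (rise3 (real n + 1 - real j) * v / N3)
        * (real j - real k + 1) * (flux_num P ((real j - real k + 1)\<^sup>2))\<^sup>2
        / (real n * flux_den P T ((real j - real k + 1)\<^sup>2))"
      unfolding flux_def Let_def b eqs ..
    finally show ?thesis by (simp add: power2_eq_square mult_ac)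
  qed
  have I1: "inflow n k j = u * v / (N3\<^sup>2 * real n) * (rise3 (real k) * rise3 y * (d + 1) * Gp / Dp)"
    using in'[of u k v j] kj by (simp add: u_def v_def defs Gp_def Dp_def mult_ac)
  have I2: "inflow n j k = u * v / (N3\<^sup>2 * real n) * (- (rise3 (real j) * rise3 x * (d - 1) * Gm / Dm))"
  proof -
    have reflect: "real k - real j + 1 = - (d - 1)" "(- (d - 1))\<^sup>2 = (d - 1)\<^sup>2"
      by (simp_all only: d_def power2_minus)
    have swap: "P = 2 * real n + 3 - real j - real k" "T = real j + real k + 3"
      by (simp_all add: P_def T_def)
    show ?thesis
      using in'[OF v_def u_def kj(1) swap]
      unfolding reflect x_def[symmetric] Gm_def[symmetric] Dm_def[symmetric]
      by (simp add: mult_ac del: minus_diff_eq)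
  qed
  have ratio: "N3 / rise3 (real n) = (real n + 3) / real n"
    using n by (simp add: N3_def rise3_def divide_simps) (simp add: algebra_simps)
  have up: "B_coeff (n + 1) k = u" "B_coeff (n + 1) j = v" by (simp_all add: u_def v_def)
  have C: "cross n k j + cross n j k = u * v / (N3\<^sup>2 * real n)
      * ((real n + 3) * (rise3 (x - 1) * rise3 x + rise3 (y - 1) * rise3 y)
         - 2 * real n * rise3 x * rise3 y)"
  proof -
    have "cross n k j + cross n j k = u * v / N3\<^sup>2
      * ((N3 / rise3 (real n)) * (rise3 (x - 1) * rise3 x + rise3 (y - 1) * rise3 y)
         - 2 * rise3 x * rise3 y)"
      unfolding cross_def row'[OF x_def u_def kj(1)] row'[OF y_def v_def kj(2)] row up
      using N3 N3' by (simp add: field_simps power2_eq_square)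
    also have "\<dots> = u * v / (N3\<^sup>2 * real n)
      * ((real n + 3) * (rise3 (x - 1) * rise3 x + rise3 (y - 1) * rise3 y)
         - 2 * real n * rise3 x * rise3 y)"
      unfolding ratio using n by (simp add: field_simps)
    finally show ?thesis .
  qed
  define A where "A = (real n + 3) * (rise3 (x - 1) * rise3 x + rise3 (y - 1) * rise3 y)
         - 2 * real n * rise3 x * rise3 y"
  define B where "B = rise3 (real k) * rise3 y * (d + 1) * Gp"
  define C where "C = rise3 (real j) * rise3 x * (d - 1) * Gm"
  have "A * Dp * Dm + B * Dm - C * Dp = 48 * d\<^sup>2 * rise3 x * rise3 y * surplus P T (d\<^sup>2)"
    unfolding A_def B_def C_def Dp_def Dm_def Gp_def Gm_def
    by (rule balance_identity) (simp_all add: defs)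
  also have "0 \<le> \<dots>"
  proof (cases "k = j")
    case False
    have "1 \<le> \<bar>int j - int k\<bar>" using False by simp
    hence "1 \<le> \<bar>d\<bar>" unfolding d_def by linarith
    hence "1 \<le> d\<^sup>2" using power_mono[of 1 "\<bar>d\<bar>" 2] by simp
    moreover have "4 \<le> T" using False by (auto simp: T_def)
    ultimately show ?thesis
      using surplus_nonneg[OF P] xy by (simp add: rise3_nonneg)
  qed (simp add: d_def)
  finally have "0 \<le> (A * Dp * Dm + B * Dm - C * Dp) / (Dp * Dm)"
    using Dp Dm by simp
  also have "\<dots> = A + B / Dp - C / Dm"
    using Dp Dm by (simp add: field_simps)
  finally have "0 \<le> u * v / (N3\<^sup>2 * real n) * (A + B / Dp - C / Dm)"
    using uv by (intro mult_nonneg_nonneg) auto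
  also have "\<dots> = cross n k j + cross n j k + inflow n k j + inflow n j k"
    unfolding C I1 I2 A_def B_def C_def by (simp add: ring_distribs)
  finally show ?thesis .
qed

section \<open>Summation against a log-convex sequence\<close>

text \<open>
  For positive sequences this says that the quotients \<open>a (m + 1) / a m\<close> increase. If some \<open>a m\<close>
  vanishes, log-convexity forces \<open>a (m + 1) = 0\<close> and the induction still goes through.
\<close>
lemma log_convex_exchange:
  assumes "log_convex a" and "i \<le> j"
  shows "a (Suc i) * a j \<le> a i * a (Suc j)"
  using assms(2)
proof (induction rule: dec_induct)
  case base
  show ?case by simp
next
  case (step j)
  have nonneg: "0 \<le> a m" for m
    using assms(1) by (simp add: log_convex_def)
  have convex: "(a (Suc j))\<^sup>2 \<le> a j * a (Suc (Suc j))"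
    using assms(1)[unfolded log_convex_def] by (auto dest: spec[of _ "Suc j"])
  show ?case
  proof (cases "a j = 0")
    case True
    hence "a (Suc j) = 0" using convex by simp
    thus ?thesis by (simp add: nonneg)
  next
    case False
    have "a j * (a (Suc i) * a (Suc j)) = (a (Suc i) * a j) * a (Suc j)"
      by simp
    also have "\<dots> \<le> (a i * a (Suc j)) * a (Suc j)"
      using step.IH nonneg by (intro mult_right_mono)
    also have "\<dots> = a i * (a (Suc j))\<^sup>2" by (simp add: power2_eq_square)
    also have "\<dots> \<le> a i * (a j * a (Suc (Suc j)))"
      using convex nonneg by (intro mult_left_mono)
    finally have "a j * (a (Suc i) * a (Suc j)) \<le> a j * (a i * a (Suc (Suc j)))"
      by (simp add: mult_ac)
    thus ?thesis
      using False nonneg[of j] by (simp add: mult_le_cancel_left)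
  qed
qed

lemma sum_antidiagonal_swap:
  fixes h :: "nat \<Rightarrow> nat \<Rightarrow> real"
  shows "(\<Sum>k\<le>t. h k (t - k)) = (\<Sum>k\<le>t. h (t - k) k)"
  by (rule sum.reindex_bij_witness[of _ "\<lambda>k. t - k" "\<lambda>k. t - k"]) auto

text \<open>
  Reindexing by the flows instead of the positions and pairing the flow along \<open>(i, j)\<close> with the
  mirrored one along \<open>(j, i)\<close> weighs \<open>flux n i j\<close> with
  \<open>a (i + 1) * a j - a i * a (j + 1)\<close>, which has the opposite sign.
\<close>
lemma inflow_sum_nonpos:
  assumes "log_convex a"
  shows "(\<Sum>k\<le>t. inflow n k (t - k) * (a k * a (t - k))) \<le> 0"
proof (cases t)
  case 0
  thus ?thesis by (simp add: inflow_def)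
next
  case (Suc s)
  let ?h = "\<lambda>i j. flux n i j * (a (Suc i) * a j)"
  have "(\<Sum>k\<le>t. inflow n k (t - k) * (a k * a (t - k))) = (\<Sum>i\<le>s. ?h i (s - i))"
    unfolding Suc by (subst sum.atMost_Suc_shift) (simp add: inflow_def)
  moreover have "(\<Sum>i\<le>s. ?h i (s - i)) + (\<Sum>i\<le>s. ?h (s - i) i) \<le> 0"
  proof -
    have "?h i j + ?h j i \<le> 0" for i j
    proof (induction i j rule: linorder_wlog)
      case (le i j)
      have "?h i j + ?h j i = flux n i j * (a (Suc i) * a j - a i * a (Suc j))"
        by (simp add: flux_antisym[of n j i] algebra_simps)
      also have "\<dots> \<le> 0"
        using flux_nonneg[OF le] log_convex_exchange[OF assms le]
        by (intro mult_nonneg_nonpos) auto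
      finally show ?case .
    qed (simp add: add.commute)
    hence "(\<Sum>i\<le>s. ?h i (s - i) + ?h (s - i) i) \<le> 0"
      by (intro sum_nonpos)
    thus ?thesis by (simp only: sum.distrib)
  qed
  ultimately show ?thesis
    using sum_antidiagonal_swap[of ?h s] by linarith
qed

text \<open>
  With the inflow added, every symmetrised coefficient is nonnegative, and the inflow itself
  contributes at most \<open>0\<close> to the sum.
\<close>
lemma cross_sum_nonneg:
  assumes a: "log_convex a" and n: "1 \<le> n"
  shows "0 \<le> (\<Sum>k\<le>t. cross n k (t - k) * (a k * a (t - k)))"
proof -
  let ?S = "\<lambda>h. \<Sum>k\<le>t. h k (t - k) * (a k * a (t - k))"
  have sym: "?S (\<lambda>k j. h j k) = ?S h" for h :: "nat \<Rightarrow> nat \<Rightarrow> real"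
    using sum_antidiagonal_swap[of "\<lambda>k j. h j k * (a k * a j)" t] by (simp add: mult_ac)
  have "0 \<le> (cross n k j + cross n j k + inflow n k j + inflow n j k) * (a k * a j)" for k j
    using cross_plus_inflow_nonneg[OF n] a by (simp add: log_convex_def)
  hence "0 \<le> ?S (\<lambda>k j. cross n k j + cross n j k + inflow n k j + inflow n j k)"
    by (intro sum_nonneg)
  also have "\<dots> = 2 * ?S (cross n) + 2 * ?S (inflow n)"
    using sym[of "cross n"] sym[of "inflow n"]
    by (simp add: distrib_right sum.distrib)
  finally show ?thesis
    using inflow_sum_nonpos[OF a, of n t] by linarith
qed

lemma B_transform_product:
  "(\<Sum>k\<le>m. B_coeff m k * a k) * (\<Sum>k\<le>n. B_coeff n k * a k)
   = (\<Sum>t\<le>m + n. \<Sum>k\<le>t. B_coeff m k * B_coeff n (t - k) * (a k * a (t - k)))"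
proof -
  have "(\<Sum>k\<le>m. (B_coeff m k * a k) * 1 ^ k) * (\<Sum>k\<le>n. (B_coeff n k * a k) * 1 ^ k)
     = (\<Sum>t\<le>m + n. (\<Sum>k\<le>t. (B_coeff m k * a k) * (B_coeff n (t - k) * a (t - k))) * 1 ^ t)"
    by (rule polynomial_product) (simp_all add: B_coeff_eq_0)
  thus ?thesis by (simp add: mult_ac)
qed

theorem theorem6p1:
  fixes a b :: "nat \<Rightarrow> real"
  assumes "log_convex a"
    and "\<And>n. b n = (\<Sum>k=0..n. B_coeff n k * a k)"
  shows "log_convex b"
proof -
  have b: "b n = (\<Sum>k\<le>n. B_coeff n k * a k)" for n
    by (simp add: assms(2) atMost_atLeast0)
  have "0 \<le> b n" for n
    using assms(1) unfolding b log_convex_def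
    by (intro sum_nonneg mult_nonneg_nonneg B_coeff_nonneg) auto
  moreover have "(b n)\<^sup>2 \<le> b (n - 1) * b (n + 1)" if n: "1 \<le> n" for n
  proof -
    have "n - 1 + (n + 1) = n + n" using n by simp
    hence "b (n - 1) * b (n + 1) - (b n)\<^sup>2
        = (\<Sum>t\<le>n + n. \<Sum>k\<le>t. cross n k (t - k) * (a k * a (t - k)))"
      unfolding b power2_eq_square B_transform_product cross_def
      by (simp add: left_diff_distrib sum_subtractf)
    also have "0 \<le> \<dots>"
      by (intro sum_nonneg cross_sum_nonneg[OF assms(1) n])
    finally show ?thesis by simp
  qed
  ultimately show ?thesis by (simp add: log_convex_def)
qed

end
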